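(* Let $X,Y$ be real Hilbert spaces, let $G\colon X\to Y'$ be a boundedly invertible linear operator, let $f\in Y'$, and let $u\in X$ be the solution of $Gu=f$. Let $\{0\}\subsetneq X^\delta\subsetneq X$ and $\{0\}\subsetneq Y^\delta\subsetneq Y$ be closed subspaces, and let $\{0\}\subsetneq \hat X^\delta\subsetneq X$ be a finite dimensional subspace, such that $$\gamma^\delta:=\inf_{0\neq w\in X^\delta}\frac{\sup_{0\neq y\in Y^\delta}\frac{|(Gw)(y)|}{\|G'y\|_{X'}}}{\|w\|_X}>0,\qquad \mu^\delta:=\inf_{0\neq v\in Y^\delta}\frac{\sup_{0\neq w\in\hat X^\delta}\frac{|(G'v)(w)|}{\|w\|_X}}{\|G'v\|_{X'}}>0 .$$ Let $(\lambda^\delta,u^\delta)\in Y^\delta\times X^\delta$ be the solution of $$\langle G'\lambda^\delta,G'\tilde\lambda^\delta\rangle_{{\hat X^\delta}'}+(Gu^\delta)(\tilde\lambda^\delta)+(G\tilde u^\delta)(\lambda^\delta)=f(\tilde\lambda^\delta)\qquad\text{for all }(\tilde\lambda^\delta,\tilde u^\delta)\in Y^\delta\times X^\delta .$$ Then $$\|u-u^\delta\|_X\le\frac{1}{\gamma^\delta\mu^\delta}\inf_{w\in X^\delta}\|u-w\|_X .$$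
   Context: For a Hilbert space $Z$, $Z'$ denotes its (topological) dual, equipped with the dual norm. The operator $G'\colon Y\to X'$ is the adjoint of $G$, i.e. $(G'v)(w)=(Gw)(v)$ for $v\in Y$, $w\in X$; it is boundedly invertible. The space $\hat X^\delta$ is equipped with the scalar product and norm of $X$. Functionals in $X'$ are regarded as elements of ${\hat X^\delta}'$ by restriction, and $\|g\|_{{\hat X^\delta}'}:=\sup_{0\neq w\in\hat X^\delta}\frac{|g(w)|}{\|w\|_X}$. The symbol $\langle\cdot,\cdot\rangle_{{\hat X^\delta}'}$ denotes the corresponding bilinear form (the scalar product on ${\hat X^\delta}'$ inducing this norm); equivalently, with $R_{\hat X^\delta}\colon{\hat X^\delta}'\to\hat X^\delta$ the Riesz map, defined by $\langle R_{\hat X^\delta}g,w\rangle_X=g(w)$ for all $w\in\hat X^\delta$, one has $\langle g,h\rangle_{{\hat X^\delta}'}=\langle R_{\hat X^\delta}g,R_{\hat X^\delta}h\rangle_X$. The superscript $\delta$ is just an index (for "discrete") labelling the chosen subspaces. *)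

theory Defs
  imports "HOL-Analysis.Analysis"
begin

text \<open>
  A real Hilbert space is a type of sort \<open>{real_inner, complete_space}\<close>; its topological dual,
  with the dual norm, is the type of bounded linear maps into \<^typ>\<open>real\<close>.
\<close>

definition boundedly_invertible ::
    "('a::real_normed_vector \<Rightarrow>\<^sub>L 'b::real_normed_vector) \<Rightarrow> bool" where
  "boundedly_invertible A \<longleftrightarrow>
     (\<exists>H :: 'b \<Rightarrow>\<^sub>L 'a. H o\<^sub>L A = id_blinfun \<and> A o\<^sub>L H = id_blinfun)"

definition dual_adjoint ::
    "('a::real_normed_vector \<Rightarrow>\<^sub>L ('b::real_normed_vector \<Rightarrow>\<^sub>L real)) \<Rightarrow> ('b \<Rightarrow>\<^sub>L ('a \<Rightarrow>\<^sub>L real))" where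
  "dual_adjoint G = Blinfun (\<lambda>v. Blinfun (\<lambda>w. G w v))"

lemma dual_adjoint_apply [simp]: "dual_adjoint G v w = G w v"
proof -
  have *: "blinfun_apply (Blinfun (\<lambda>w. G w v)) = (\<lambda>w. G w v)" for v
    by (intro bounded_linear_Blinfun_apply bounded_linear_intros)
  have "bounded_linear (\<lambda>v. Blinfun (\<lambda>w. G w v))"
  proof (rule bounded_linear_intro[where K = "norm G"])
    fix x y :: 'b and r :: real
    show "Blinfun (\<lambda>w. G w (x + y)) = Blinfun (\<lambda>w. G w x) + Blinfun (\<lambda>w. G w y)"
      by (rule blinfun_eqI) (simp only: * blinfun.add_left, simp only: blinfun.add_right)
    show "Blinfun (\<lambda>w. G w (r *\<^sub>R x)) = r *\<^sub>R Blinfun (\<lambda>w. G w x)"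
      by (rule blinfun_eqI) (simp only: * blinfun.scaleR_left, simp only: blinfun.scaleR_right)
    show "norm (Blinfun (\<lambda>w. G w x)) \<le> norm x * norm G"
    proof (rule norm_blinfun_bound)
      fix w
      have "norm (G w x) \<le> norm (G w) * norm x" by (rule norm_blinfun)
      also have "\<dots> \<le> (norm G * norm w) * norm x"
        by (intro mult_right_mono norm_blinfun) simp
      finally show "norm (Blinfun (\<lambda>w. G w x) w) \<le> norm x * norm G * norm w"
        by (simp add: * mult_ac)
    qed simp
  qed
  then show ?thesis
    by (simp add: dual_adjoint_def bounded_linear_Blinfun_apply *)
qed

text \<open>
  The Riesz map of a finite dimensional subspace \<open>V\<close>. Only the values of \<open>g\<close> on \<open>V\<close> enter, so a
  functional on the whole space is used through its restriction to \<open>V\<close>.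
\<close>

definition riesz_on :: "'a::real_inner set \<Rightarrow> ('a \<Rightarrow>\<^sub>L real) \<Rightarrow> 'a" where
  "riesz_on V g = (THE r. r \<in> V \<and> (\<forall>w\<in>V. r \<bullet> w = g w))"

lemma riesz_on_span_ex:
  fixes g :: "'a::real_inner \<Rightarrow>\<^sub>L real"
  assumes "finite B"
  shows "\<exists>r\<in>span B. \<forall>w\<in>span B. r \<bullet> w = g w"
  using assms
proof (induction B arbitrary: g rule: finite_induct)
  case empty
  then show ?case by simp
next
  case (insert b B)
  obtain r where r: "r \<in> span B" "\<And>w. w \<in> span B \<Longrightarrow> r \<bullet> w = g w"
    using insert.IH[of g] by blast
  obtain p where p: "p \<in> span B" "\<And>w. w \<in> span B \<Longrightarrow> p \<bullet> w = b \<bullet> w"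
    using insert.IH[of "blinfun_inner_right b"] by auto
  define e where "e = b - p"
  have orth: "e \<bullet> w = 0" if "w \<in> span B" for w
    using p(2)[OF that] by (simp add: e_def inner_diff_left)
  show ?case
  proof (cases "e = 0")
    case True
    then have "span (insert b B) = span B"
      using p(1) by (simp add: e_def span_redundant)
    then show ?thesis using r by auto
  next
    case False
    define r' where "r' = r + (g e / (e \<bullet> e)) *\<^sub>R e"
    have sub: "span B \<subseteq> span (insert b B)" by (rule span_mono) auto
    have "e \<in> span (insert b B)"
      unfolding e_def using p(1) sub by (intro span_diff) (auto intro: span_base)
    then have "r' \<in> span (insert b B)"
      unfolding r'_def using r(1) sub by (intro span_add span_scale) auto
    moreover have "r' \<bullet> w = g w" if w: "w \<in> span (insert b B)" for w
    proof -
      obtain k where k: "w - k *\<^sub>R b \<in> span B"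
        using w by (auto simp: span_breakdown_eq)
      define s where "s = (w - k *\<^sub>R b) + k *\<^sub>R p"
      have s: "s \<in> span B" unfolding s_def using k p(1) by (intro span_add span_scale)
      have w_eq: "w = s + k *\<^sub>R e" by (simp add: s_def e_def algebra_simps)
      have "r \<bullet> e = 0" using orth[OF r(1)] by (simp add: inner_commute)
      then have "r' \<bullet> w = g s + k * g e"
        using False r(2)[OF s] orth[OF s] by (simp add: r'_def w_eq inner_simps)
      then show ?thesis by (simp add: w_eq blinfun.bilinear_simps)
    qed
    ultimately show ?thesis by blast
  qed
qed

lemma riesz_on:
  assumes "subspace V" and "\<exists>B. finite B \<and> span B = V"
  shows riesz_on_mem: "riesz_on V g \<in> V"
    and riesz_on_inner: "\<And>w. w \<in> V \<Longrightarrow> riesz_on V g \<bullet> w = g w"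
proof -
  have "\<exists>!r. r \<in> V \<and> (\<forall>w\<in>V. r \<bullet> w = g w)"
  proof (rule ex_ex1I)
    show "\<exists>r. r \<in> V \<and> (\<forall>w\<in>V. r \<bullet> w = g w)"
      using assms(2) riesz_on_span_ex[of _ g] by blast
  next
    fix r s assume rs: "r \<in> V \<and> (\<forall>w\<in>V. r \<bullet> w = g w)" "s \<in> V \<and> (\<forall>w\<in>V. s \<bullet> w = g w)"
    then have "r - s \<in> V" using assms(1) by (simp add: subspace_diff)
    with rs have "(r - s) \<bullet> (r - s) = 0" by (simp add: inner_diff_left)
    then show "r = s" by simp
  qed
  from theI'[OF this] show "riesz_on V g \<in> V" "\<And>w. w \<in> V \<Longrightarrow> riesz_on V g \<bullet> w = g w"
    unfolding riesz_on_def by blast+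
qed

definition dual_inner_on :: "'a::real_inner set \<Rightarrow> ('a \<Rightarrow>\<^sub>L real) \<Rightarrow> ('a \<Rightarrow>\<^sub>L real) \<Rightarrow> real" where
  "dual_inner_on V g h = riesz_on V g \<bullet> riesz_on V h"

text \<open>
  The infima and suprema below are taken in \<^typ>\<open>real\<close>. They are the genuine ones when the
  subspaces are nonzero and \<open>dual_adjoint G\<close> is injective: the index sets are then nonempty, the
  inner quotients are bounded above by \<open>norm w\<close> and by \<open>norm (dual_adjoint G v)\<close> respectively, and
  the outer ones are bounded below by \<open>0\<close>.
\<close>

definition gamma_const ::
    "('a::real_normed_vector \<Rightarrow>\<^sub>L ('b::real_normed_vector \<Rightarrow>\<^sub>L real)) \<Rightarrow> 'a set \<Rightarrow> 'b set \<Rightarrow> real" where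
  "gamma_const G Xd Yd =
     (INF w\<in>Xd - {0}. (SUP y\<in>Yd - {0}. \<bar>G w y\<bar> / norm (dual_adjoint G y)) / norm w)"

definition mu_const ::
    "('a::real_normed_vector \<Rightarrow>\<^sub>L ('b::real_normed_vector \<Rightarrow>\<^sub>L real)) \<Rightarrow> 'b set \<Rightarrow> 'a set \<Rightarrow> real" where
  "mu_const G Yd Xh =
     (INF v\<in>Yd - {0}. (SUP w\<in>Xh - {0}. \<bar>dual_adjoint G v w\<bar> / norm w) / norm (dual_adjoint G v))"

end

theory Submission
  imports Defs
begin

text \<open>
  The discrete solution map \<open>P : u \<mapsto> ud\<close> is idempotent, and a projector on a Hilbert space that is
  neither \<open>0\<close> nor the identity has the same norm as its complement. Hence the stability constant
  of \<open>P\<close> is also the quasi-optimality constant, without the additive \<open>1\<close> of the triangle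
  inequality. For stability, let \<open>K\<close> be the space of \<open>v \<in> Yd\<close> with \<open>G w v = 0\<close> for all
  \<open>w \<in> Xd\<close>. The multiplier \<open>lam\<close> lies in \<open>K\<close>, so for the part \<open>z\<close> of \<open>y \<in> Yd\<close> that is
  orthogonal to \<open>K\<close> in the discrete dual inner product, \<open>G ud y = G ud z = f z\<close>. This is at most
  \<open>norm u * norm (G' z)\<close>, and passing from \<open>norm (G' z)\<close> to the discrete norm, in which \<open>z\<close> is
  no larger than \<open>y\<close>, costs the factor \<open>1 / \<mu>\<close>. The splitting exists because the Riesz images
  lie in the finite dimensional space \<open>Xh\<close>.
\<close>

section \<open>Norms of complementary projections\<close>

text \<open>
  The hypothesis says that on the plane spanned by \<open>p\<close> and \<open>q\<close> the oblique projection onto \<open>p\<close>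
  along \<open>q\<close> has norm at most \<open>C\<close>; the conclusion is the same bound for its complement.
  The case \<open>p = 0\<close> is what requires \<open>C \<ge> 1\<close>.
\<close>

lemma norm_complementary_projection_le:
  fixes p q :: "'a::real_inner"
  assumes "C \<ge> 1" and bound: "\<And>a b. norm (a *\<^sub>R p) \<le> C * norm (a *\<^sub>R p + b *\<^sub>R q)"
  shows "norm q \<le> C * norm (p + q)"
proof (cases "p = 0 \<or> q = 0")
  case True
  then show ?thesis
    using \<open>C \<ge> 1\<close> mult_right_mono[of 1 C "norm q"] by auto
next
  case False
  then have pp: "p \<bullet> p > 0" and qq: "q \<bullet> q > 0" by auto
  \<comment> \<open>Up to the factor \<open>q \<bullet> q\<close>, which avoids a division,
    \<open>r\<close> is the component of \<open>p\<close> orthogonal to \<open>q\<close>; the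
    hypothesis is sharpest there.\<close>
  define r where "r = (q \<bullet> q) *\<^sub>R p + (- (p \<bullet> q)) *\<^sub>R q"
  have rr: "r \<bullet> r = (q \<bullet> q) * ((q \<bullet> q) * (p \<bullet> p) - (p \<bullet> q)\<^sup>2)"
    by (simp add: r_def inner_simps inner_commute[of q p] power2_eq_square algebra_simps)
  have "(norm ((q \<bullet> q) *\<^sub>R p))\<^sup>2 \<le> (C * norm r)\<^sup>2"
    unfolding r_def by (intro power_mono bound) simp
  then have "(q \<bullet> q) * ((q \<bullet> q) * (p \<bullet> p)) \<le> (q \<bullet> q) * (C\<^sup>2 * ((q \<bullet> q) * (p \<bullet> p) - (p \<bullet> q)\<^sup>2))"
    by (simp add: power_mult_distrib power2_norm_eq_inner rr) (simp add: power2_eq_square mult_ac)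
  then have "(q \<bullet> q) * (p \<bullet> p) \<le> C\<^sup>2 * ((q \<bullet> q) * (p \<bullet> p) - (p \<bullet> q)\<^sup>2)"
    using qq by simp
  also have "\<dots> \<le> C\<^sup>2 * (((p + q) \<bullet> (p + q)) * (p \<bullet> p))"
  proof (rule mult_left_mono)
    \<comment> \<open>Adding \<open>p\<close> to \<open>q\<close> does not change their Gram
      determinant, so this difference is the square of \<open>(p + q) \<bullet> p\<close>.\<close>
    have "((p + q) \<bullet> (p + q)) * (p \<bullet> p) - ((q \<bullet> q) * (p \<bullet> p) - (p \<bullet> q)\<^sup>2) = (p \<bullet> p + p \<bullet> q)\<^sup>2"
      by (simp add: inner_simps inner_commute[of q p] power2_eq_square algebra_simps)
    then have "0 \<le> ((p + q) \<bullet> (p + q)) * (p \<bullet> p) - ((q \<bullet> q) * (p \<bullet> p) - (p \<bullet> q)\<^sup>2)"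
      by (metis zero_le_power2)
    then show "(q \<bullet> q) * (p \<bullet> p) - (p \<bullet> q)\<^sup>2 \<le> ((p + q) \<bullet> (p + q)) * (p \<bullet> p)"
      by (simp only: diff_ge_0_iff_ge)
  qed simp
  finally have "(q \<bullet> q) * (p \<bullet> p) \<le> (C\<^sup>2 * ((p + q) \<bullet> (p + q))) * (p \<bullet> p)"
    by (simp add: mult_ac)
  then have "(norm q)\<^sup>2 \<le> (C * norm (p + q))\<^sup>2"
    using pp by (simp add: power_mult_distrib power2_norm_eq_inner)
  then show ?thesis
    by (rule power2_le_imp_le) (use \<open>C \<ge> 1\<close> in simp)
qed

section \<open>Orthogonal splitting through a finite dimensional image\<close>

lemma subspace_of_finite_span:
  assumes "subspace V" and "V \<subseteq> span B" and "finite B"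
  shows "\<exists>T. finite T \<and> span T = V"
proof -
  obtain T where T: "T \<subseteq> V" "independent T" "V \<subseteq> span T"
    using maximal_independent_subset by blast
  have "finite T"
    using independent_span_bound[OF \<open>finite B\<close> T(2)] T(1) assms(2) by blast
  moreover have "span T = V"
    using T assms(1) by (simp add: span_minimal subset_antisym)
  ultimately show ?thesis by blast
qed

text \<open>The projection is made in the image of \<open>K\<close>, which is finite dimensional
  even if \<open>K\<close> is not; a preimage of the projected point serves as
  \<open>k\<close>.\<close>

lemma linear_image_orthogonal_split:
  fixes L :: "'a::real_vector \<Rightarrow> 'b::real_inner"
  assumes "linear L" and "subspace K" and "L ` K \<subseteq> span B" and "finite B"
  obtains k where "k \<in> K" and "\<And>v. v \<in> K \<Longrightarrow> L (y - k) \<bullet> L v = 0"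
proof -
  obtain T where T: "finite T" "span T = L ` K"
    using subspace_of_finite_span[OF linear_subspace_image[OF assms(1,2)] assms(3,4)] by blast
  obtain s where s: "s \<in> L ` K" "\<And>w. w \<in> L ` K \<Longrightarrow> s \<bullet> w = L y \<bullet> w"
    using riesz_on_span_ex[OF T(1), of "blinfun_inner_right (L y)"] T(2) by auto
  then obtain k where "k \<in> K" "s = L k" by blast
  with s have "L (y - k) \<bullet> L v = 0" if "v \<in> K" for v
    using that by (simp add: linear_diff[OF assms(1)] inner_diff_left)
  with \<open>k \<in> K\<close> show thesis using that by blast
qed

section \<open>The Riesz map of a finite dimensional subspace\<close>

context
  fixes V :: "'a::real_inner set"
  assumes V: "subspace V" "\<exists>B. finite B \<and> span B = V"
begin

lemma riesz_on_unique:
  fixes g :: "'a \<Rightarrow>\<^sub>L real"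
  assumes "r \<in> V" and "\<And>w. w \<in> V \<Longrightarrow> r \<bullet> w = g w"
  shows "riesz_on V g = r"
proof -
  have "riesz_on V g - r \<in> V"
    using riesz_on_mem[OF V] assms(1) V(1) by (simp add: subspace_diff)
  then have "(riesz_on V g - r) \<bullet> (riesz_on V g - r) = 0"
    using riesz_on_inner[OF V] assms(2) by (simp add: inner_diff_left)
  then show ?thesis by simp
qed

lemma linear_riesz_on: "linear (riesz_on V)"
proof (rule linearI)
  show "riesz_on V (g + h) = riesz_on V g + riesz_on V h" for g h
    by (rule riesz_on_unique)
      (simp_all add: V(1) subspace_add riesz_on_mem[OF V] riesz_on_inner[OF V] inner_add_left
        blinfun.add_left)
  show "riesz_on V (c *\<^sub>R g) = c *\<^sub>R riesz_on V g" for c g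
    by (rule riesz_on_unique)
      (simp_all add: V(1) subspace_scale riesz_on_mem[OF V] riesz_on_inner[OF V]
        blinfun.scaleR_left)
qed

lemma norm_riesz_on_le: "norm (riesz_on V g) \<le> norm g"
proof -
  let ?r = "riesz_on V g"
  have "norm ?r * norm ?r = g ?r"
    using riesz_on_inner[OF V riesz_on_mem[OF V], of g g]
    by (simp add: dot_square_norm power2_eq_square)
  also have "\<dots> \<le> norm g * norm ?r"
    using norm_blinfun[of g ?r] by simp
  finally show ?thesis
    by (cases "?r = 0") auto
qed

lemma quotient_le_norm_riesz_on:
  fixes g :: "'a \<Rightarrow>\<^sub>L real"
  assumes "w \<in> V"
  shows "\<bar>g w\<bar> / norm w \<le> norm (riesz_on V g)"
  using Cauchy_Schwarz_ineq2[of "riesz_on V g" w] riesz_on_inner[OF V assms, of g]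
  by (cases "w = 0") (simp_all add: divide_simps)

end

section \<open>Estimates from the two inf-sup constants\<close>

lemma abs_apply_le_dual_adjoint:
  fixes G :: "'a::real_normed_vector \<Rightarrow>\<^sub>L ('b::real_normed_vector \<Rightarrow>\<^sub>L real)"
  shows "\<bar>G w y\<bar> \<le> norm (dual_adjoint G y) * norm w"
  using norm_blinfun[of "dual_adjoint G y" w] by simp

lemma gamma_const_le:
  fixes G :: "'a::real_normed_vector \<Rightarrow>\<^sub>L ('b::real_normed_vector \<Rightarrow>\<^sub>L real)"
  assumes "p \<in> Xd" and "{0} \<subset> Yd"
    and c: "\<And>y. y \<in> Yd \<Longrightarrow> \<bar>G p y\<bar> \<le> c * norm (dual_adjoint G y)" and "c \<ge> 0"
  shows "gamma_const G Xd Yd * norm p \<le> c"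
proof (cases "p = 0")
  case False
  define S where "S w = (SUP y\<in>Yd - {0}. \<bar>G w y\<bar> / norm (dual_adjoint G y))" for w
  obtain y0 where y0: "y0 \<in> Yd - {0}" using assms(2) by blast
  \<comment> \<open>A zero denominator makes the quotient \<open>0\<close>, so this case is
    harmless.\<close>
  have quot: "\<bar>G w y\<bar> / norm (dual_adjoint G y) \<le> norm w" for w y
    using abs_apply_le_dual_adjoint[of G w y]
    by (cases "dual_adjoint G y = 0") (simp_all add: divide_simps mult_ac)
  \<comment> \<open>This bounds the outer quotients below, as comparing a real-valued
    \<open>INF\<close> with its terms requires.\<close>
  have "0 \<le> S w" for w
    unfolding S_def by (rule cSUP_upper2[OF _ y0]) (auto intro: bdd_aboveI2 quot)
  then have "gamma_const G Xd Yd \<le> S p / norm p"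
    unfolding gamma_const_def S_def[symmetric]
    using assms(1) False by (intro cINF_lower bdd_belowI2[where m = 0]) auto
  also have "S p \<le> c"
    unfolding S_def
  proof (rule cSUP_least)
    fix y assume "y \<in> Yd - {0}"
    then show "\<bar>G p y\<bar> / norm (dual_adjoint G y) \<le> c"
      using c[of y] \<open>c \<ge> 0\<close> by (cases "dual_adjoint G y = 0") (simp_all add: divide_simps)
  qed (use y0 in blast)
  finally show ?thesis
    using False by (simp add: divide_simps)
qed (use assms in simp)

text \<open>A converse to \<open>norm_riesz_on_le\<close>: restricting
  \<open>dual_adjoint G v\<close> to \<open>Xh\<close> shrinks its norm by no more than the factor
  \<open>mu_const G Yd Xh\<close>.\<close>

lemma mu_const_le:
  fixes G :: "'a::real_inner \<Rightarrow>\<^sub>L ('b::real_normed_vector \<Rightarrow>\<^sub>L real)"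
  assumes "v \<in> Yd" and Xh: "subspace Xh" "\<exists>B. finite B \<and> span B = Xh" and "{0} \<subset> Xh"
  shows "mu_const G Yd Xh * norm (dual_adjoint G v) \<le> norm (riesz_on Xh (dual_adjoint G v))"
proof (cases "dual_adjoint G v = 0")
  case False
  then have "v \<noteq> 0" by (auto simp: blinfun.zero_right)
  define S where "S v = (SUP w\<in>Xh - {0}. \<bar>dual_adjoint G v w\<bar> / norm w)" for v
  obtain w0 where w0: "w0 \<in> Xh - {0}" using assms(4) by blast
  have quot: "\<bar>dual_adjoint G v w\<bar> / norm w \<le> norm (riesz_on Xh (dual_adjoint G v))"
    if "w \<in> Xh - {0}" for v w
    using quotient_le_norm_riesz_on[OF Xh] that by blast
  have "0 \<le> S v" for v
    unfolding S_def by (rule cSUP_upper2[OF _ w0]) (auto intro!: bdd_aboveI2 quot simp del: dual_adjoint_apply)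
  then have "mu_const G Yd Xh \<le> S v / norm (dual_adjoint G v)"
    unfolding mu_const_def S_def[symmetric]
    using assms(1) \<open>v \<noteq> 0\<close> by (intro cINF_lower bdd_belowI2[where m = 0]) auto
  also have "S v \<le> norm (riesz_on Xh (dual_adjoint G v))"
    unfolding S_def using w0 quot by (intro cSUP_least) auto
  finally show ?thesis
    using False by (simp add: divide_simps)
qed simp

section \<open>The discrete saddle point problem\<close>

text \<open>With \<open>G u\<close> as the datum, the relation between \<open>u\<close> and
  \<open>p\<close> is linear, so stability applies to every solution built from a given one.\<close>

definition saddle_solution ::
    "('a::real_inner \<Rightarrow>\<^sub>L ('b::real_inner \<Rightarrow>\<^sub>L real)) \<Rightarrow> 'a set \<Rightarrow> 'b set \<Rightarrow> 'a set \<Rightarrow> 'a \<Rightarrow> 'b \<Rightarrow> 'a \<Rightarrow> bool"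
  where
  "saddle_solution G Xd Yd Xh u lam p \<longleftrightarrow> lam \<in> Yd \<and> p \<in> Xd \<and>
     (\<forall>lam'\<in>Yd. \<forall>w\<in>Xd.
        dual_inner_on Xh (dual_adjoint G lam) (dual_adjoint G lam') + G p lam' + G w lam = G u lam')"

context
  fixes G :: "'a::real_inner \<Rightarrow>\<^sub>L ('b::real_inner \<Rightarrow>\<^sub>L real)"
    and Xd Xh :: "'a set" and Yd :: "'b set"
  assumes Xd: "subspace Xd" and Yd: "subspace Yd" "{0} \<subset> Yd"
    and Xh: "subspace Xh" "\<exists>B. finite B \<and> span B = Xh" "{0} \<subset> Xh"
begin

lemma linear_riesz_on_dual_adjoint: "linear (\<lambda>v. riesz_on Xh (dual_adjoint G v))"
  using linear_compose[OF _ linear_riesz_on[OF Xh(1,2)], of "dual_adjoint G"]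
  by (simp add: o_def blinfun.bounded_linear_right bounded_linear.linear)

lemma saddle_solution_stable:
  assumes sol: "saddle_solution G Xd Yd Xh u lam p"
    and gamma: "gamma_const G Xd Yd > 0" and mu: "mu_const G Yd Xh > 0"
  shows "norm p \<le> 1 / (gamma_const G Xd Yd * mu_const G Yd Xh) * norm u"
proof -
  let ?\<mu> = "mu_const G Yd Xh"
  define L where "L v = riesz_on Xh (dual_adjoint G v)" for v
  have L: "linear L"
    unfolding L_def by (rule linear_riesz_on_dual_adjoint)
  have "lam \<in> Yd" "p \<in> Xd"
    and eq: "\<And>v w. v \<in> Yd \<Longrightarrow> w \<in> Xd \<Longrightarrow> L lam \<bullet> L v + G p v + G w lam = G u v"
    using sol unfolding saddle_solution_def dual_inner_on_def L_def by auto
  have "0 \<in> Xd" "0 \<in> Yd" using Xd Yd by (simp_all add: subspace_0)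
  define K where "K = {v \<in> Yd. \<forall>w\<in>Xd. G w v = 0}"
  have "subspace K"
    using Yd(1) by (auto simp: K_def subspace_def blinfun.bilinear_simps)
  \<comment> \<open>Testing with \<open>v = 0\<close> leaves only \<open>G w lam\<close>.\<close>
  have "lam \<in> K"
    using \<open>lam \<in> Yd\<close> eq[OF \<open>0 \<in> Yd\<close>] by (simp add: K_def linear_0[OF L] blinfun.zero_right)
  obtain B where B: "finite B" "span B = Xh" using Xh(2) by blast
  have "L ` K \<subseteq> span B"
    using riesz_on_mem[OF Xh(1,2)] by (auto simp: L_def B)
  have "\<bar>G p y\<bar> \<le> (norm u / ?\<mu>) * norm (dual_adjoint G y)" if y: "y \<in> Yd" for y
  proof -
    obtain k where k: "k \<in> K" and orth: "\<And>v. v \<in> K \<Longrightarrow> L (y - k) \<bullet> L v = 0"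
      using linear_image_orthogonal_split[OF L \<open>subspace K\<close> \<open>L ` K \<subseteq> span B\<close> B(1)] by blast
    define z where "z = y - k"
    have "k \<in> Yd" and Gpk: "G p k = 0" using k \<open>p \<in> Xd\<close> by (auto simp: K_def)
    then have z: "z \<in> Yd" using y Yd(1) by (simp add: z_def subspace_diff)
    have "G p y = G p z" using Gpk by (simp add: z_def blinfun.diff_right)
    \<comment> \<open>Test with \<open>v = z\<close> and \<open>w = 0\<close>; the inner product
      vanishes because \<open>L z\<close> is orthogonal to \<open>L lam\<close>.\<close>
    also have "\<dots> = G u z"
      using eq[OF z \<open>0 \<in> Xd\<close>] orth[OF \<open>lam \<in> K\<close>]
      by (simp add: z_def inner_commute blinfun.zero_left blinfun.zero_right)
    finally have Gpy: "G p y = G u z" .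
    have "?\<mu> * norm (dual_adjoint G z) \<le> norm (L z)"
      using mu_const_le[OF z Xh] by (simp add: L_def)
    also have "norm (L z) \<le> norm (L y)"
    proof -
      have split: "L y = L z + L k" by (simp add: z_def linear_diff[OF L])
      have "orthogonal (L z) (L k)"
        using orth[OF k] by (simp add: z_def orthogonal_def)
      then have "(norm (L y))\<^sup>2 = (norm (L z))\<^sup>2 + (norm (L k))\<^sup>2"
        unfolding split by (rule norm_add_Pythagorean)
      then have "(norm (L z))\<^sup>2 \<le> (norm (L y))\<^sup>2" by simp
      then show ?thesis by (rule power2_le_imp_le[OF _ norm_ge_zero])
    qed
    also have "norm (L y) \<le> norm (dual_adjoint G y)"
      unfolding L_def by (rule norm_riesz_on_le[OF Xh(1,2)])
    finally have "?\<mu> * norm (dual_adjoint G z) \<le> norm (dual_adjoint G y)" .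
    from order_trans[OF mult_left_mono[OF abs_apply_le_dual_adjoint[of G u z], of ?\<mu>]
        mult_right_mono[OF this norm_ge_zero[of u], unfolded mult.assoc]]
    have "\<bar>G p y\<bar> * ?\<mu> \<le> norm u * norm (dual_adjoint G y)"
      using mu by (simp add: Gpy mult.commute)
    then show ?thesis
      using mu by (simp add: pos_le_divide_eq)
  qed
  moreover have "norm u / ?\<mu> \<ge> 0" using mu by simp
  ultimately have "gamma_const G Xd Yd * norm p \<le> norm u / ?\<mu>"
    by (rule gamma_const_le[OF \<open>p \<in> Xd\<close> Yd(2)])
  then show ?thesis
    using gamma mu by (simp add: pos_le_divide_eq mult_ac)
qed

text \<open>The discrete solution map fixes \<open>Xd\<close> and annihilates the error \<open>u - p\<close>.\<close>

lemma saddle_solution_combination: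
  assumes "saddle_solution G Xd Yd Xh u lam p"
  shows "saddle_solution G Xd Yd Xh (a *\<^sub>R p + b *\<^sub>R (u - p)) (b *\<^sub>R lam) (a *\<^sub>R p)"
  unfolding saddle_solution_def
proof (intro conjI ballI)
  have "lam \<in> Yd" "p \<in> Xd"
    and eq: "\<And>v w. v \<in> Yd \<Longrightarrow> w \<in> Xd \<Longrightarrow>
      dual_inner_on Xh (dual_adjoint G lam) (dual_adjoint G v) + G p v + G w lam = G u v"
    using assms unfolding saddle_solution_def by auto
  then show "b *\<^sub>R lam \<in> Yd" "a *\<^sub>R p \<in> Xd"
    using Xd Yd(1) by (simp_all add: subspace_scale)
  fix v w assume "v \<in> Yd" "w \<in> Xd"
  have "dual_inner_on Xh (dual_adjoint G (b *\<^sub>R lam)) (dual_adjoint G v)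
      = b * dual_inner_on Xh (dual_adjoint G lam) (dual_adjoint G v)"
    by (simp add: dual_inner_on_def linear_cmul[OF linear_riesz_on_dual_adjoint])
  then show "dual_inner_on Xh (dual_adjoint G (b *\<^sub>R lam)) (dual_adjoint G v)
      + G (a *\<^sub>R p) v + G w (b *\<^sub>R lam) = G (a *\<^sub>R p + b *\<^sub>R (u - p)) v"
    using eq[OF \<open>v \<in> Yd\<close> \<open>w \<in> Xd\<close>, symmetric]
    by (simp add: blinfun.bilinear_simps algebra_simps)
qed

text \<open>The error is the same for both solutions, which brings an arbitrary competitor
  \<open>w\<close> into the final bound.\<close>

lemma saddle_solution_shift:
  assumes "saddle_solution G Xd Yd Xh u lam p" and "w \<in> Xd"
  shows "saddle_solution G Xd Yd Xh (u - w) lam (p - w)"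
  using assms Xd unfolding saddle_solution_def
  by (auto simp: subspace_diff blinfun.bilinear_simps algebra_simps)

lemma saddle_solution_self:
  assumes "w \<in> Xd"
  shows "saddle_solution G Xd Yd Xh w 0 w"
  using assms Yd(1) unfolding saddle_solution_def dual_inner_on_def
  by (simp add: subspace_0 linear_0[OF linear_riesz_on[OF Xh(1,2)]] blinfun.zero_right)

end

theorem proposition3p1:
  fixes G :: "'x::{real_inner, complete_space} \<Rightarrow>\<^sub>L ('y::{real_inner, complete_space} \<Rightarrow>\<^sub>L real)"
    and f :: "'y \<Rightarrow>\<^sub>L real"
    and u ud :: 'x
    and lam :: 'y
    and Xd Xh :: "'x set"
    and Yd :: "'y set"
  assumes "boundedly_invertible G"
    and "G u = f"
    and "subspace Xd" and "closed Xd" and "{0} \<subset> Xd" and "Xd \<subset> UNIV"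
    and "subspace Yd" and "closed Yd" and "{0} \<subset> Yd" and "Yd \<subset> UNIV"
    and "subspace Xh" and "\<exists>B. finite B \<and> span B = Xh" and "{0} \<subset> Xh" and "Xh \<subset> UNIV"
    and "gamma_const G Xd Yd > 0"
    and "mu_const G Yd Xh > 0"
    and "lam \<in> Yd" and "ud \<in> Xd"
    and "\<forall>lam'\<in>Yd. \<forall>ud'\<in>Xd.
           dual_inner_on Xh (dual_adjoint G lam) (dual_adjoint G lam') + G ud lam' + G ud' lam
             = f lam'"
  shows "norm (u - ud)
           \<le> 1 / (gamma_const G Xd Yd * mu_const G Yd Xh) * (INF w\<in>Xd. norm (u - w))"
proof -
  let ?C = "1 / (gamma_const G Xd Yd * mu_const G Yd Xh)"
  note spaces = \<open>subspace Xd\<close> \<open>subspace Yd\<close> \<open>{0} \<subset> Yd\<close> \<open>subspace Xh\<close>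
    \<open>\<exists>B. finite B \<and> span B = Xh\<close> \<open>{0} \<subset> Xh\<close>
  note stable = saddle_solution_stable[OF spaces _ \<open>gamma_const G Xd Yd > 0\<close> \<open>mu_const G Yd Xh > 0\<close>]
  have sol: "saddle_solution G Xd Yd Xh u lam ud"
    using assms unfolding saddle_solution_def by simp
  obtain x where x: "x \<in> Xd" "x \<noteq> 0" using \<open>{0} \<subset> Xd\<close> by blast
  \<comment> \<open>A datum in \<open>Xd\<close> is its own discrete solution, so stability at a
    nonzero \<open>x\<close> forces the constant to be at least 1.\<close>
  have "1 * norm x \<le> ?C * norm x"
    using stable[OF saddle_solution_self[OF spaces x(1)]] by simp
  then have "?C \<ge> 1"
    using x(2) by (simp only: mult_le_cancel_right) simp
  have "norm (u - ud) \<le> ?C * norm (u - w)" if "w \<in> Xd" for w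
  proof -
    have shifted: "saddle_solution G Xd Yd Xh (u - w) lam (ud - w)"
      by (rule saddle_solution_shift[OF spaces sol that])
    \<comment> \<open>The complementary pair is \<open>ud - w\<close> and \<open>u - ud\<close>,
      with sum \<open>u - w\<close>.\<close>
    have "norm (a *\<^sub>R (ud - w)) \<le> ?C * norm (a *\<^sub>R (ud - w) + b *\<^sub>R (u - ud))" for a b
      using stable[OF saddle_solution_combination[OF spaces shifted, of a b]] by simp
    from norm_complementary_projection_le[OF \<open>?C \<ge> 1\<close> this]
    show ?thesis by simp
  qed
  \<comment> \<open>The constant moves to the left so that the quotient is a lower bound for the
    infimum.\<close>
  then have "norm (u - ud) / ?C \<le> norm (u - w)" if "w \<in> Xd" for w
    using that \<open>?C \<ge> 1\<close> pos_divide_le_eq[of ?C "norm (u - ud)" "norm (u - w)"]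
    by (simp only: mult.commute)
  then have "norm (u - ud) / ?C \<le> (INF w\<in>Xd. norm (u - w))"
    using x(1) by (intro cINF_greatest) auto
  then show ?thesis
    using \<open>?C \<ge> 1\<close> pos_divide_le_eq[of ?C "norm (u - ud)"]
    by (simp only: mult.commute)
qed

end
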